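(* Assume that for all $K\in\mathcal T$ and $0\le n\le N-1$ one has $\eta>1$ and $$\delta t\le\frac{|K|}{2\sum_{\sigma\in\mathcal E(K),\,\sigma=K|L}|\sigma|\bigl(-(w^n_{\sigma,K})^-\bigr)}.$$ Then there exists $C>0$ such that for any $1\le n\le N-1$ the numerical solution of the limit scheme $[\mathcal P_0^{h_{\mathcal T}}]$ satisfies $$\sum_{K\in\mathcal T}|K|\,\frac12|\mathbf v_K^n|^2+(\eta-1)\sum_{r=0}^{n-1}\delta t^2\sum_{K\in\mathcal T}|K|\,\bigl|(\nabla_{\mathcal T}\pi^{r+1})_K\bigr|^2\le C.$$
   Context: **Mesh.** $d\in\{2,3\}$; periodic boundary conditions, $\Omega=\mathbb T^d$. $\mathcal T$ is a finite family of closed axis-parallel (possibly non-uniform) rectangles/cuboids $K$ covering $\overline\Omega$; two distinct cells share no edge or exactly one edge $\sigma=K|L$. $\mathcal E(K)$: the edges (faces) of $K$; $\mathcal E_{ext}$: edges on $\partial\Omega$; $|K|,|\sigma|$: Lebesgue measures; $\boldsymbol\nu_{\sigma,K}$: unit normal to $\sigma$ outward from $K$. $\mathcal L_{\mathcal T}(\Omega)$ (resp. $\mathcal L_{\mathcal T}(\Omega;\mathbb R^d)$): scalar (vector) functions constant on each $K$ (value $q_K$); $(\Pi_{\mathcal T}q)_K=|K|^{-1}\int_Kq\,dx$; $\{\!\{q\}\!\}_\sigma=(q_K+q_L)/2$ for $\sigma=K|L$. **Discrete operators.** $w_{\sigma,K}=\{\!\{\mathbf w\}\!\}_\sigma\cdot\boldsymbol\nu_{\sigma,K}$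 if $\sigma=K|L$ and $0$ if $\sigma\in\mathcal E_{ext}$; $(\mathrm{div}_{\mathcal T}\mathbf w)_K=|K|^{-1}\sum_{\sigma\in\mathcal E(K)}|\sigma|w_{\sigma,K}$; $(\nabla_{\mathcal T}q)_K=|K|^{-1}\sum_{\sigma=K|L\in\mathcal E(K)}|\sigma|\frac{q_L-q_K}2\boldsymbol\nu_{\sigma,K}$; $(\mathrm{div}^{up}_{\mathcal T}(\mathbf q,\mathbf w))_K=|K|^{-1}\sum_{\sigma=K|L\in\mathcal E(K)}|\sigma|\{\mathbf q_K(w_{\sigma,K})^++\mathbf q_L(w_{\sigma,K})^-\}$. Write $a^\pm=(a\pm|a|)/2$. **Limit scheme $[\mathcal P_0^{h_{\mathcal T}}]$.** $t^n=n\,\delta t$, $t^N=T$; $\mathbf v^0=\Pi_{\mathcal T}\mathbf v_0$, where $\mathbf v_0\in H^s(\Omega;\mathbb R^d)$, $s>d/2+1$, $\mathrm{div}_x\mathbf v_0=0$. For $0\le n\le N-1$, $(\mathbf v^{n+1},\pi^{n+1})\in\mathcal L_{\mathcal T}(\Omega;\mathbb R^d)\times\mathcal L_{\mathcal T}(\Omega)$ satisfies for all $K\in\mathcal T$ $(\mathrm{div}_{\mathcal T}(\mathbf v^n-\delta\mathbf v^{n+1}))_K=0$, $\frac1{\delta t}(\mathbf v_K^{n+1}-\mathbf v_K^n)+(\mathrm{div}^{up}_{\mathcal T}(\mathbf v^n,\mathbf v^n-\delta\mathbf v^{n+1}))_K+(\nabla_{\mathcal T}\pi^{n+1})_K=0$,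 with $\delta\mathbf v^{n+1}_K=\eta\,\delta t(\nabla_{\mathcal T}\pi^{n+1})_K$, $\eta>0$ a constant. Here $\mathbf w^n=\mathbf v^n-\delta\mathbf v^{n+1}$ and $(w^n_{\sigma,K})^+=v_{\sigma,K}^{n,+}-\delta v_{\sigma,K}^{n+1,-}\ge0$, $(w^n_{\sigma,K})^-=v_{\sigma,K}^{n,-}-\delta v_{\sigma,K}^{n+1,+}\le0$. *)

theory Defs
  imports "HOL-Analysis.Analysis"
begin

section \<open>The flat torus and the initial datum\<close>

text \<open>Functions on the torus are functions on \<open>\<real>\<^sup>d\<close> with period 1 in every coordinate;
  \<open>cbox 0 1\<close> is a fundamental domain.\<close>

definition int_lattice :: "(real ^ 'd) set" where
  "int_lattice = {z. \<forall>i. z $ i \<in> \<int>}"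

definition periodic :: "(real ^ 'd \<Rightarrow> 'b) \<Rightarrow> bool" where
  "periodic f \<longleftrightarrow> (\<forall>x. \<forall>z\<in>int_lattice. f (x + z) = f x)"

definition fourier_coeff :: "(real ^ 'd \<Rightarrow> real) \<Rightarrow> real ^ 'd \<Rightarrow> complex" where
  "fourier_coeff f k =
     (LINT x:cbox 0 1|lebesgue. complex_of_real (f x) * cis (- (2 * pi * (k \<bullet> x))))"

text \<open>\<open>H\<^sup>s\<close> of the torus for real \<open>s\<close>, vector valued. Members are periodic representatives of
  almost-everywhere classes.\<close>

definition sobolev_torus :: "real \<Rightarrow> (real ^ 'd \<Rightarrow> real ^ 'd) set" where
  "sobolev_torus s = {u. periodic u \<and> u \<in> borel_measurable lebesgue \<and>
     set_integrable lebesgue (cbox 0 1) (\<lambda>x. (norm (u x))\<^sup>2) \<and>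
     (\<lambda>k. (1 + (norm k)\<^sup>2) powr s * (\<Sum>j\<in>UNIV. (cmod (fourier_coeff (\<lambda>x. u x $ j) k))\<^sup>2))
       summable_on int_lattice}"

definition partial_deriv :: "'d \<Rightarrow> (real ^ 'd \<Rightarrow> real) \<Rightarrow> real ^ 'd \<Rightarrow> real" where
  "partial_deriv i f x = frechet_derivative f (at x) (axis i 1)"

primrec C_k :: "nat \<Rightarrow> (real ^ 'd \<Rightarrow> real) \<Rightarrow> bool" where
  "C_k 0 f = continuous_on UNIV f"
| "C_k (Suc m) f = ((\<forall>x. f differentiable at x) \<and> (\<forall>i. C_k m (partial_deriv i f)))"

text \<open>\<open>div u = 0\<close> in the sense of distributions on the torus; this does not depend on the
  representative of \<open>u\<close>, and is the classical condition when \<open>u\<close> is continuously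
  differentiable.\<close>

definition divergence_free :: "(real ^ 'd \<Rightarrow> real ^ 'd) \<Rightarrow> bool" where
  "divergence_free u \<longleftrightarrow>
     (\<forall>\<phi>. periodic \<phi> \<and> (\<forall>m. C_k m \<phi>) \<longrightarrow>
        (LINT x:cbox 0 1|lebesgue. u x \<bullet> (\<chi> i. partial_deriv i \<phi> x)) = 0)"


section \<open>Periodic meshes\<close>

text \<open>A cell of the torus is represented by one box in \<open>\<real>\<^sup>d\<close>; its other lifts are the translates
  by lattice vectors. The edges (faces, if \<open>d = 3\<close>) of a cell are its facets. A cell \<open>K\<close> and the
  lift of \<open>L\<close> by \<open>z\<close> share an edge iff their intersection is a facet of both.\<close>

type_synonym 'd cell = "(real ^ 'd) set"
type_synonym 'd edge = "'d cell \<times> (real ^ 'd)"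

definition lift :: "real ^ 'd \<Rightarrow> 'd cell \<Rightarrow> 'd cell" where
  "lift z L = (+) z ` L"

definition share_edge :: "'d cell \<Rightarrow> 'd cell \<Rightarrow> real ^ 'd \<Rightarrow> bool" where
  "share_edge K L z \<longleftrightarrow> (K \<inter> lift z L) facet_of K \<and> (K \<inter> lift z L) facet_of (lift z L)"

text \<open>The third and fourth clauses say that the cells tile the torus. The fifth says that every
  edge of a cell is an interior edge: the torus has no boundary, so there are no exterior edges.
  The last says that two distinct cells have at most one edge in common.\<close>

definition periodic_mesh :: "('d::finite) cell set \<Rightarrow> bool" where
  "periodic_mesh \<T> \<longleftrightarrow>
     finite \<T> \<and>
     (\<forall>K\<in>\<T>. \<exists>a b. (\<forall>i. a $ i < b $ i) \<and> K = cbox a b) \<and>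
     (\<Union>K\<in>\<T>. \<Union>z\<in>int_lattice. lift z K) = UNIV \<and>
     (\<forall>K\<in>\<T>. \<forall>L\<in>\<T>. \<forall>z\<in>int_lattice. (L, z) \<noteq> (K, 0) \<longrightarrow>
        interior K \<inter> interior (lift z L) = {}) \<and>
     (\<forall>K\<in>\<T>. \<forall>\<sigma>. \<sigma> facet_of K \<longrightarrow>
        (\<exists>L\<in>\<T>. \<exists>z\<in>int_lattice. \<sigma> = K \<inter> lift z L \<and> share_edge K L z)) \<and>
     (\<forall>K\<in>\<T>. \<forall>L\<in>\<T>. \<forall>z\<in>int_lattice. \<forall>z'\<in>int_lattice.
        K \<noteq> L \<and> share_edge K L z \<and> share_edge K L z' \<longrightarrow> z = z')"

text \<open>The edges \<open>\<sigma> = K|L\<close> of \<open>K\<close>, encoded as pairs \<open>(L, z)\<close> with \<open>\<sigma> = K \<inter> lift z L\<close>.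
  A cell that wraps around the torus and meets a lift of itself does so along two opposite facets;
  as its values agree on both sides and the two normals are opposite, their contributions to each
  operator below vanish or cancel, and they are left out.\<close>

definition edges :: "('d::finite) cell set \<Rightarrow> 'd cell \<Rightarrow> 'd edge set" where
  "edges \<T> K = {(L, z). L \<in> \<T> \<and> L \<noteq> K \<and> z \<in> int_lattice \<and> share_edge K L z}"

definition edge_set :: "'d cell \<Rightarrow> 'd edge \<Rightarrow> (real ^ 'd) set" where
  "edge_set K e = K \<inter> lift (snd e) (fst e)"

definition cell_measure :: "('d::finite) cell \<Rightarrow> real" where
  "cell_measure K = measure lebesgue K"

text \<open>The \<open>(d-1)\<close>-dimensional Lebesgue measure of an axis-parallel \<open>(d-1)\<close>-dimensional box:
  the product of its nonzero side lengths.\<close>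

definition edge_measure :: "(real ^ 'd) set \<Rightarrow> real" where
  "edge_measure \<sigma> =
     (\<Prod>i\<in>{i. interval_lowerbound \<sigma> $ i < interval_upperbound \<sigma> $ i}.
        interval_upperbound \<sigma> $ i - interval_lowerbound \<sigma> $ i)"

definition outer_normal :: "(real ^ 'd) set \<Rightarrow> 'd cell \<Rightarrow> real ^ 'd" where
  "outer_normal \<sigma> K = (THE \<nu>. norm \<nu> = 1 \<and> (\<forall>x\<in>\<sigma>. \<forall>y\<in>\<sigma>. \<nu> \<bullet> (y - x) = 0) \<and>
     (\<forall>x\<in>\<sigma>. \<forall>y\<in>K. \<nu> \<bullet> (y - x) \<le> 0))"


section \<open>Discrete functions and operators\<close>

text \<open>A discrete function is given by its cell values.\<close>

definition projection :: "(real ^ 'd \<Rightarrow> real ^ 'd) \<Rightarrow> 'd cell \<Rightarrow> real ^ 'd" where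
  "projection u K = (1 / cell_measure K) *\<^sub>R (LINT x:K|lebesgue. u x)"

definition pos_part :: "real \<Rightarrow> real" where
  "pos_part a = (a + \<bar>a\<bar>) / 2"

definition neg_part :: "real \<Rightarrow> real" where
  "neg_part a = (a - \<bar>a\<bar>) / 2"

definition normal_comp ::
    "('d cell \<Rightarrow> real ^ 'd) \<Rightarrow> 'd cell \<Rightarrow> 'd edge \<Rightarrow> real" where
  "normal_comp w K e = ((1 / 2) *\<^sub>R (w K + w (fst e))) \<bullet> outer_normal (edge_set K e) K"

definition disc_div ::
    "'d cell set \<Rightarrow> ('d cell \<Rightarrow> real ^ 'd) \<Rightarrow> 'd cell \<Rightarrow> real" where
  "disc_div \<T> w K = (1 / cell_measure K) *
     (\<Sum>e\<in>edges \<T> K. edge_measure (edge_set K e) * normal_comp w K e)"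

definition disc_grad ::
    "'d cell set \<Rightarrow> ('d cell \<Rightarrow> real) \<Rightarrow> 'd cell \<Rightarrow> real ^ 'd" where
  "disc_grad \<T> q K = (1 / cell_measure K) *\<^sub>R
     (\<Sum>e\<in>edges \<T> K. (edge_measure (edge_set K e) * ((q (fst e) - q K) / 2)) *\<^sub>R
        outer_normal (edge_set K e) K)"

text \<open>The nonnegative and nonpositive flux parts \<open>wp\<close> and \<open>wm\<close> are arguments, because the scheme
  does not use the positive and negative part of the sum \<open>wp + wm\<close> itself.\<close>

definition disc_div_up ::
    "'d cell set \<Rightarrow> ('d cell \<Rightarrow> real ^ 'd) \<Rightarrow>
     ('d cell \<Rightarrow> 'd edge \<Rightarrow> real) \<Rightarrow>
     ('d cell \<Rightarrow> 'd edge \<Rightarrow> real) \<Rightarrow> 'd cell \<Rightarrow> real ^ 'd" where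
  "disc_div_up \<T> q wp wm K = (1 / cell_measure K) *\<^sub>R
     (\<Sum>e\<in>edges \<T> K. edge_measure (edge_set K e) *\<^sub>R (wp K e *\<^sub>R q K + wm K e *\<^sub>R q (fst e)))"


section \<open>The limit scheme\<close>

definition velocity_shift ::
    "'d cell set \<Rightarrow> real \<Rightarrow> real \<Rightarrow> ('d cell \<Rightarrow> real) \<Rightarrow> 'd cell \<Rightarrow> real ^ 'd" where
  "velocity_shift \<T> \<eta> \<delta>t p K = (\<eta> * \<delta>t) *\<^sub>R disc_grad \<T> p K"

text \<open>The splitting of the normal component of \<open>v - \<delta>v\<close> into a nonnegative and a nonpositive
  part.\<close>

definition flux_plus ::
    "('d cell \<Rightarrow> real ^ 'd) \<Rightarrow> ('d cell \<Rightarrow> real ^ 'd) \<Rightarrow> 'd cell \<Rightarrow> 'd edge \<Rightarrow> real" where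
  "flux_plus v \<delta>v K e = pos_part (normal_comp v K e) - neg_part (normal_comp \<delta>v K e)"

definition flux_minus ::
    "('d cell \<Rightarrow> real ^ 'd) \<Rightarrow> ('d cell \<Rightarrow> real ^ 'd) \<Rightarrow> 'd cell \<Rightarrow> 'd edge \<Rightarrow> real" where
  "flux_minus v \<delta>v K e = neg_part (normal_comp v K e) - pos_part (normal_comp \<delta>v K e)"

definition limit_scheme ::
    "'d cell set \<Rightarrow> (real ^ 'd \<Rightarrow> real ^ 'd) \<Rightarrow> real \<Rightarrow> real \<Rightarrow> nat \<Rightarrow>
     (nat \<Rightarrow> 'd cell \<Rightarrow> real ^ 'd) \<Rightarrow> (nat \<Rightarrow> 'd cell \<Rightarrow> real) \<Rightarrow> bool" where
  "limit_scheme \<T> v\<^sub>0 \<eta> \<delta>t N v p \<longleftrightarrow>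
     (\<forall>K\<in>\<T>. v 0 K = projection v\<^sub>0 K) \<and>
     (\<forall>n<N. \<forall>K\<in>\<T>.
        let \<delta>v = velocity_shift \<T> \<eta> \<delta>t (p (Suc n)) in
          disc_div \<T> (\<lambda>L. v n L - \<delta>v L) K = 0 \<and>
          (1 / \<delta>t) *\<^sub>R (v (Suc n) K - v n K)
            + disc_div_up \<T> (v n) (flux_plus (v n) \<delta>v) (flux_minus (v n) \<delta>v) K
            + disc_grad \<T> (p (Suc n)) K = 0)"

text \<open>The time step restriction \<open>\<delta>t \<le> |K| / (2 S)\<close>. It is void if \<open>S = 0\<close>, where the quotient
  means \<open>\<infinity>\<close> and not 0.\<close>

definition time_step_condition ::
    "'d cell set \<Rightarrow> real \<Rightarrow> real \<Rightarrow> nat \<Rightarrow>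
     (nat \<Rightarrow> 'd cell \<Rightarrow> real ^ 'd) \<Rightarrow> (nat \<Rightarrow> 'd cell \<Rightarrow> real) \<Rightarrow> bool" where
  "time_step_condition \<T> \<eta> \<delta>t N v p \<longleftrightarrow>
     (\<forall>n<N. \<forall>K\<in>\<T>.
        let \<delta>v = velocity_shift \<T> \<eta> \<delta>t (p (Suc n));
            S = (\<Sum>e\<in>edges \<T> K. edge_measure (edge_set K e) * (- flux_minus (v n) \<delta>v K e))
        in S \<noteq> 0 \<longrightarrow> \<delta>t \<le> cell_measure K / (2 * S))"

end

theory Submission
  imports Defs
begin

text \<open>Test the momentum equation with \<open>v\<^sup>n\<close>. Since \<open>w\<^sup>n = v\<^sup>n - \<delta>v\<^sup>n\<^sup>+\<^sup>1\<close> is discretely divergence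
  free, upwinding dissipates energy at rate \<open>D / 2\<close> with \<open>D = \<Sum>\<^sub>K \<Sum>\<^sub>\<sigma> |\<sigma>| (- w\<^sup>-) |v\<^sub>L - v\<^sub>K|\<^sup>2\<close>, and by duality of
  gradient and divergence the pressure term equals \<open>\<Sum> |K| \<nabla>\<pi> \<bullet> \<delta>v = \<eta> \<delta>t \<Sum> |K| |\<nabla>\<pi>|\<^sup>2\<close>. As the
  scheme is explicit, the energy also gains \<open>\<Sum> |K| |v\<^sup>n\<^sup>+\<^sup>1 - v\<^sup>n|\<^sup>2 / 2 \<le> \<delta>t\<^sup>2 \<Sum> |K| (|div\<^sup>u\<^sup>p|\<^sup>2 + |\<nabla>\<pi>|\<^sup>2)\<close>.
  By Cauchy-Schwarz and the time step condition, the first part is at most \<open>\<delta>t D / 2\<close>; the second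
  leaves the factor \<open>\<eta> - 1\<close>. Summing over the time steps bounds the left-hand side by the initial
  energy, which is at most half the squared \<open>L\<^sup>2\<close> norm of \<open>v\<^sub>0\<close> over the torus, whatever the mesh.\<close>

section \<open>Reciprocity of interior edges\<close>

text \<open>The hyperplanes through a point of \<open>F\<close> with normals \<open>a\<close> and
  \<open>b\<close> both equal the affine hull of \<open>F\<close>, so \<open>a\<close> and
  \<open>b\<close> are parallel.\<close>

lemma unit_normal_unique_up_to_sign:
  fixes F :: "'a::euclidean_space set"
  assumes F: "F \<noteq> {}" "aff_dim F = int DIM('a) - 1"
    and a: "norm a = 1" "\<forall>x\<in>F. \<forall>y\<in>F. a \<bullet> (y - x) = 0"
    and b: "norm b = 1" "\<forall>x\<in>F. \<forall>y\<in>F. b \<bullet> (y - x) = 0"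
  shows "a = b \<or> a = - b"
proof -
  obtain x0 where x0: "x0 \<in> F" using F by auto
  have hull: "affine hull F = {x. c \<bullet> x = c \<bullet> x0}"
    if "norm c = 1" "\<forall>x\<in>F. \<forall>y\<in>F. c \<bullet> (y - x) = 0" for c
  proof -
    have "F \<subseteq> {x. c \<bullet> x = c \<bullet> x0}"
    proof
      fix x assume "x \<in> F"
      then have "c \<bullet> (x - x0) = 0" using that(2) x0 by blast
      then show "x \<in> {x. c \<bullet> x = c \<bullet> x0}" by (simp add: inner_diff_right)
    qed
    moreover have "aff_dim {x. c \<bullet> x = c \<bullet> x0} = int DIM('a) - 1"
      using that(1) by (subst aff_dim_hyperplane) auto
    ultimately show ?thesis
      using F(2) aff_dim_eq_full_gen[of F "{x. c \<bullet> x = c \<bullet> x0}"]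
      by (simp add: affine_hyperplane hull_same)
  qed
  have "{x. a \<bullet> x = a \<bullet> x0} = {x. b \<bullet> x = b \<bullet> x0}"
    using hull[OF a] hull[OF b] by simp
  \<comment> \<open>The part of \<open>b\<close> orthogonal to \<open>a\<close> is a direction of
    the common hyperplane; testing it with \<open>b\<close> forces equality in
    Cauchy-Schwarz.\<close>
  moreover have "a \<bullet> (x0 + (b - (a \<bullet> b) *\<^sub>R a)) = a \<bullet> x0"
    using a(1) by (simp add: inner_add_right inner_diff_right dot_square_norm)
  ultimately have "b \<bullet> (x0 + (b - (a \<bullet> b) *\<^sub>R a)) = b \<bullet> x0"
    by blast
  then have "(a \<bullet> b)\<^sup>2 = 1"
    using b(1) by (simp add: inner_add_right inner_diff_right dot_square_norm power2_eq_square
        inner_commute)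
  then consider "a \<bullet> b = 1" | "a \<bullet> b = -1"
    by (auto simp: power2_eq_1_iff)
  then show ?thesis
  proof cases
    case 1
    then have "(norm (a - b))\<^sup>2 = 0"
      using a(1) b(1) dot_norm_neg[of a b] by simp
    then show ?thesis by simp
  next
    case 2
    then have "(norm (a + b))\<^sup>2 = 0"
      using a(1) b(1) dot_norm[of a b] by simp
    then show ?thesis by (simp add: add_eq_0_iff2)
  qed
qed

lemma outer_normal_eqI:
  fixes F K :: "(real ^ 'd) set"
  assumes F: "F \<noteq> {}" "aff_dim F = int CARD('d) - 1"
    and K: "interior K \<noteq> {}"
    and a: "norm a = 1" "\<forall>x\<in>F. \<forall>y\<in>F. a \<bullet> (y - x) = 0"
      "\<forall>x\<in>F. \<forall>y\<in>K. a \<bullet> (y - x) \<le> 0"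
  shows "outer_normal F K = a"
  unfolding outer_normal_def
proof (rule the_equality)
  have dim: "aff_dim F = int DIM(real ^ 'd) - 1" using F(2) by simp
  fix b :: "real ^ 'd"
  assume b: "norm b = 1 \<and> (\<forall>x\<in>F. \<forall>y\<in>F. b \<bullet> (y - x) = 0) \<and>
    (\<forall>x\<in>F. \<forall>y\<in>K. b \<bullet> (y - x) \<le> 0)"
  have "b \<noteq> - a"
  proof
    assume ba: "b = - a"
    obtain x0 where x0: "x0 \<in> F" using F by auto
    have "K \<subseteq> {y. a \<bullet> y = a \<bullet> x0}"
      using a(3) b x0 by (fastforce simp: ba inner_diff_right)
    moreover have "interior {y. a \<bullet> y = a \<bullet> x0} = {}"
      using a(1) by (intro interior_hyperplane) auto
    ultimately show False
      using K interior_mono by blast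
  qed
  then show "b = a"
    using unit_normal_unique_up_to_sign[of F b a] F(1) dim a(1,2) b by blast
qed (use a in blast)

text \<open>A hyperplane separating the interiors also separates the sets themselves, and the common
  facet lies in it. Its unit normal serves \<open>K\<close>, the opposite one serves
  \<open>M\<close>.\<close>

lemma outer_normal_opposite:
  fixes K M :: "(real ^ 'd) set"
  assumes K: "convex K" "interior K \<noteq> {}" and M: "convex M" "interior M \<noteq> {}"
    and disj: "interior K \<inter> interior M = {}"
    and F: "K \<inter> M \<noteq> {}" "aff_dim (K \<inter> M) = int CARD('d) - 1"
  shows "outer_normal (K \<inter> M) M = - outer_normal (K \<inter> M) K"
proof -
  obtain c \<beta> where c: "c \<noteq> 0" and cK: "\<forall>x\<in>interior K. c \<bullet> x \<le> \<beta>"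
    and cM: "\<forall>x\<in>interior M. c \<bullet> x \<ge> \<beta>"
    using separating_hyperplane_sets[of "interior K" "interior M"] K M disj
    by (auto simp: convex_interior)
  have cl: "X \<subseteq> closure (interior X)" if "convex X" "interior X \<noteq> {}" for X :: "(real ^ 'd) set"
    using convex_closure_interior[OF that] closure_subset by auto
  have cK': "c \<bullet> x \<le> \<beta>" if "x \<in> K" for x
  proof -
    have "closure (interior K) \<subseteq> {x. c \<bullet> x \<le> \<beta>}"
      using cK by (intro closure_minimal closed_halfspace_le) auto
    then show ?thesis using cl[OF K] that by auto
  qed
  have cM': "c \<bullet> x \<ge> \<beta>" if "x \<in> M" for x
  proof -
    have "closure (interior M) \<subseteq> {x. c \<bullet> x \<ge> \<beta>}"
      using cM by (intro closure_minimal closed_halfspace_ge) auto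
    then show ?thesis using cl[OF M] that by auto
  qed
  define a where "a = c /\<^sub>R norm c"
  have a: "norm a = 1" using c by (simp add: a_def)
  have sgn: "a \<bullet> x = (c \<bullet> x) / norm c" for x
    by (simp add: a_def field_simps)
  \<comment> \<open>Taking \<open>x\<close> in all of \<open>M\<close>, not only in the facet,
    yields both the equality on the facet and the inequality for \<open>- a\<close> on
    \<open>M\<close>.\<close>
  have aK: "a \<bullet> (y - x) \<le> 0" if "x \<in> M" "y \<in> K" for x y
  proof -
    have "c \<bullet> (y - x) \<le> 0"
      using cK'[OF that(2)] cM'[OF that(1)] by (simp add: inner_diff_right)
    then show ?thesis by (simp add: sgn divide_nonpos_nonneg)
  qed
  have eq: "a \<bullet> (y - x) = 0" if "x \<in> K \<inter> M" "y \<in> K \<inter> M" for x y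
    using aK[of x y] aK[of y x] that by (simp add: inner_diff_right)
  have "outer_normal (K \<inter> M) K = a"
    using a eq aK K F by (intro outer_normal_eqI) auto
  moreover have "outer_normal (K \<inter> M) M = - a"
  proof (rule outer_normal_eqI)
    show "\<forall>x\<in>K \<inter> M. \<forall>y\<in>M. - a \<bullet> (y - x) \<le> 0"
      using aK by (simp add: inner_diff_right)
  qed (use a eq M F in auto)
  ultimately show ?thesis by simp
qed

section \<open>Lattice translates of cells and edges\<close>

lemma outer_normal_lift: "outer_normal (lift z F) (lift z K) = outer_normal F K"
  by (simp add: outer_normal_def lift_def)

lemma lift_lift: "lift a (lift b K) = lift (a + b) K"
  by (auto simp: lift_def image_image add.assoc)

lemma lift_0 [simp]: "lift 0 K = K"
  by (simp add: lift_def)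

lemma lift_Int: "lift z (K \<inter> L) = lift z K \<inter> lift z L"
  by (auto simp: lift_def)

lemma lift_cbox: "lift z (cbox a b) = cbox (z + a) (z + b)"
  by (simp add: lift_def cbox_translation)

lemma interior_lift: "interior (lift z K) = lift z (interior K)"
  by (simp add: lift_def interior_translation)

text \<open>Translation by \<open>- z\<close> preserves facets, so the edge encoded at
  \<open>K\<close> as \<open>(L, z)\<close> is encoded at \<open>L\<close> as
  \<open>(K, - z)\<close>.\<close>

lemma share_edge_lift: "share_edge K L z \<longleftrightarrow> share_edge L K (- z)"
proof -
  have *: "F facet_of K \<longleftrightarrow> lift z F facet_of lift z K" for F K :: "'a cell" and z
    by (simp add: lift_def facet_of_def face_of_translation_eq aff_dim_translation_eq)
  have "L \<inter> lift (- z) K = lift (- z) (K \<inter> lift z L)"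
    by (simp add: lift_Int lift_lift Int_commute)
  then show ?thesis
    using *[of "K \<inter> lift z L" K "- z"] *[of "K \<inter> lift z L" "lift z L" "- z"]
    by (auto simp: share_edge_def lift_lift)
qed

lemma edge_set_swap: "edge_set L (K, - z) = lift (- z) (edge_set K (L, z))"
  by (simp add: edge_set_def lift_Int lift_lift Int_commute)

lemma edge_measure_nonneg: "edge_measure \<sigma> \<ge> 0"
  by (auto simp: edge_measure_def intro!: prod_nonneg)

lemma edge_measure_lift_cbox:
  assumes "cbox a b \<noteq> {}"
  shows "edge_measure (lift z (cbox a b)) = edge_measure (cbox a b)"
proof -
  have "\<forall>i\<in>Basis. a \<bullet> i \<le> b \<bullet> i" using assms by (simp add: box_ne_empty)
  then show ?thesis
    by (simp add: lift_cbox edge_measure_def inner_add_left)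
qed

lemma uminus_int_lattice: "z \<in> int_lattice \<Longrightarrow> - z \<in> int_lattice"
  by (simp add: int_lattice_def)

section \<open>Cells, edges and the exchange of the two sides of an edge\<close>

locale mesh =
  fixes \<T> :: "'d::finite cell set"
  assumes periodic_mesh: "periodic_mesh \<T>"
begin

lemma finite_mesh: "finite \<T>"
  using periodic_mesh by (simp add: periodic_mesh_def)

lemma cellE:
  assumes "K \<in> \<T>"
  obtains a b where "\<And>i. a $ i < b $ i" "K = cbox a b"
proof -
  have "\<forall>K\<in>\<T>. \<exists>a b. (\<forall>i. a $ i < b $ i) \<and> K = cbox a b"
    using periodic_mesh unfolding periodic_mesh_def by (elim conjE)
  then show thesis using assms that by blast
qed

lemma interior_disjoint:
  assumes "K \<in> \<T>" "L \<in> \<T>" "z \<in> int_lattice" "(L, z) \<noteq> (K, 0)"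
  shows "interior K \<inter> interior (lift z L) = {}"
proof -
  have "\<forall>K\<in>\<T>. \<forall>L\<in>\<T>. \<forall>z\<in>int_lattice. (L, z) \<noteq> (K, 0) \<longrightarrow>
      interior K \<inter> interior (lift z L) = {}"
    using periodic_mesh unfolding periodic_mesh_def by (elim conjE)
  then show ?thesis using assms by blast
qed

lemma shared_edge_unique:
  assumes "K \<in> \<T>" "L \<in> \<T>" "z \<in> int_lattice" "z' \<in> int_lattice"
    and "K \<noteq> L" "share_edge K L z" "share_edge K L z'"
  shows "z = z'"
proof -
  have "\<forall>K\<in>\<T>. \<forall>L\<in>\<T>. \<forall>z\<in>int_lattice. \<forall>z'\<in>int_lattice.
      K \<noteq> L \<and> share_edge K L z \<and> share_edge K L z' \<longrightarrow> z = z'"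
    using periodic_mesh unfolding periodic_mesh_def by (elim conjE)
  then show ?thesis using assms by blast
qed

lemma convex_cell: "K \<in> \<T> \<Longrightarrow> convex K"
  by (metis cellE convex_box(1))

lemma interior_cell:
  assumes "K \<in> \<T>" shows "interior K \<noteq> {}"
proof -
  obtain a b where "\<And>i. a $ i < b $ i" "K = cbox a b" using cellE[OF assms] by metis
  then show ?thesis by (simp add: interval_ne_empty_cart)
qed

lemma cell_measure_pos:
  assumes "K \<in> \<T>" shows "cell_measure K > 0"
proof -
  obtain a b where K: "\<And>i. a $ i < b $ i" "K = cbox a b" using cellE[OF assms] by metis
  have "\<forall>i\<in>Basis. a \<bullet> i < b \<bullet> i"
    using K(1) by (auto simp: Basis_vec_def inner_axis)
  then show ?thesis
    using content_pos_lt[of a b] by (simp add: K cell_measure_def)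
qed

text \<open>By the uniqueness clause of the mesh, an edge of \<open>K\<close> is determined by the
  neighbouring cell.\<close>

lemma finite_edges: "finite (edges \<T> K)" if "K \<in> \<T>"
proof -
  have "inj_on fst (edges \<T> K)"
    using shared_edge_unique[OF that] by (force simp: inj_on_def edges_def)
  moreover have "fst ` edges \<T> K \<subseteq> \<T>"
    by (auto simp: edges_def)
  ultimately show ?thesis
    using finite_mesh finite_subset inj_on_finite by blast
qed

lemma edge_fst: "e \<in> edges \<T> K \<Longrightarrow> fst e \<in> \<T>"
  by (auto simp: edges_def)

lemma edges_swap:
  assumes "K \<in> \<T>" "(L, z) \<in> edges \<T> K" shows "(K, - z) \<in> edges \<T> L"
  using assms share_edge_lift[of K L z] by (auto simp: edges_def uminus_int_lattice)

text \<open>Exchanging the sides of an edge, \<open>(K, (L, z))\<close> to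
  \<open>(L, (K, - z))\<close>, is an involution on pairs of a cell and an edge. Every discrete
  integration by parts below rests on this reindexing.\<close>

lemma edge_sum_swap:
  fixes g :: "'d cell \<Rightarrow> 'd edge \<Rightarrow> 'b::comm_monoid_add"
  shows "(\<Sum>K\<in>\<T>. \<Sum>e\<in>edges \<T> K. g K e) =
         (\<Sum>K\<in>\<T>. \<Sum>e\<in>edges \<T> K. g (fst e) (K, - snd e))"
proof -
  have "(\<Sum>K\<in>\<T>. \<Sum>e\<in>edges \<T> K. g K e) = (\<Sum>(K, e)\<in>Sigma \<T> (edges \<T>). g K e)"
    by (intro sum.Sigma) (auto simp: finite_mesh finite_edges)
  also have "\<dots> = (\<Sum>(K, e)\<in>Sigma \<T> (edges \<T>). g (fst e) (K, - snd e))"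
    by (rule sum.reindex_bij_witness[where
          i = "\<lambda>(K, e). (fst e, (K, - snd e))" and j = "\<lambda>(K, e). (fst e, (K, - snd e))"])
       (auto simp: edges_swap edge_fst dest: edge_fst)
  also have "\<dots> = (\<Sum>K\<in>\<T>. \<Sum>e\<in>edges \<T> K. g (fst e) (K, - snd e))"
    by (intro sum.Sigma[symmetric]) (auto simp: finite_mesh finite_edges)
  finally show ?thesis .
qed

text \<open>The two encodings are translates of one nonempty box.\<close>

lemma edge_measure_swap:
  assumes "K \<in> \<T>" "(L, z) \<in> edges \<T> K"
  shows "edge_measure (edge_set L (K, - z)) = edge_measure (edge_set K (L, z))"
proof -
  have L: "L \<in> \<T>" and ne: "K \<inter> lift z L \<noteq> {}"
    using assms by (auto simp: edges_def share_edge_def facet_of_def)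
  obtain a b c d where "K = cbox a b" "L = cbox c d"
    using cellE[OF assms(1)] cellE[OF L] by metis
  then obtain l u where "edge_set K (L, z) = cbox l u"
    by (auto simp: edge_set_def lift_cbox Int_interval)
  moreover have "edge_set K (L, z) \<noteq> {}" using ne by (simp add: edge_set_def)
  ultimately show ?thesis
    by (simp add: edge_set_swap edge_measure_lift_cbox)
qed

text \<open>Moved by \<open>z\<close>, the facet seen from \<open>L\<close> becomes the facet seen
  from \<open>K\<close>, where the two cells have disjoint interiors and hence opposite
  normals.\<close>

lemma outer_normal_swap:
  assumes "K \<in> \<T>" "(L, z) \<in> edges \<T> K"
  shows "outer_normal (edge_set L (K, - z)) L = - outer_normal (edge_set K (L, z)) K"
proof -
  let ?M = "lift z L"
  have L: "L \<in> \<T>" "L \<noteq> K" "z \<in> int_lattice" and F: "(K \<inter> ?M) facet_of K"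
    using assms by (auto simp: edges_def share_edge_def)
  have "outer_normal (edge_set L (K, - z)) L = outer_normal (lift (- z) (K \<inter> ?M)) (lift (- z) ?M)"
    unfolding edge_set_swap by (simp add: lift_lift edge_set_def)
  also have "\<dots> = outer_normal (K \<inter> ?M) ?M"
    by (rule outer_normal_lift)
  also have "\<dots> = - outer_normal (K \<inter> ?M) K"
  proof (rule outer_normal_opposite)
    show "convex ?M" using L convex_cell by (simp add: lift_def convex_translation)
    show "interior ?M \<noteq> {}" using L interior_cell[of L] unfolding interior_lift by (simp add: lift_def)
    show "interior K \<inter> interior ?M = {}" using L assms by (intro interior_disjoint) auto
    have "aff_dim K = int CARD('d)"
      using interior_cell[OF assms(1)] by (simp add: aff_dim_nonempty_interior)
    then show "aff_dim (K \<inter> ?M) = int CARD('d) - 1" "K \<inter> ?M \<noteq> {}"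
      using F by (auto simp: facet_of_def)
  qed (use assms convex_cell interior_cell in auto)
  finally show ?thesis by (simp add: edge_set_def)
qed

text \<open>The average is symmetric and the normal antisymmetric in the two cells, so the fluxes
  are conservative.\<close>

lemma normal_comp_swap:
  assumes "K \<in> \<T>" "e \<in> edges \<T> K"
  shows "normal_comp w (fst e) (K, - snd e) = - normal_comp w K e"
  using outer_normal_swap[of K "fst e" "snd e"] assms
  by (simp add: normal_comp_def add.commute)

end

section \<open>Stability of the projection in the square norm\<close>

lemma int_lattice_diff: "y \<in> int_lattice \<Longrightarrow> z \<in> int_lattice \<Longrightarrow> y - z \<in> int_lattice"
  by (simp add: int_lattice_def)

lemma countable_int_lattice: "countable (int_lattice :: (real ^ 'd) set)"
proof (rule countable_subset)
  show "(int_lattice :: (real ^ 'd) set) \<subseteq> range (\<lambda>f :: 'd \<Rightarrow> int. \<chi> i. of_int (f i))"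
  proof
    fix z :: "real ^ 'd" assume "z \<in> int_lattice"
    then have "z = (\<chi> i. of_int \<lfloor>z $ i\<rfloor>)"
      by (simp add: int_lattice_def vec_eq_iff)
    then show "z \<in> range (\<lambda>f :: 'd \<Rightarrow> int. \<chi> i. of_int (f i))"
      by (rule image_eqI[where x = "\<lambda>i. \<lfloor>z $ i\<rfloor>"]) simp
  qed
qed simp

lemma
  fixes z :: "'a::euclidean_space"
  shows lebesgue_measurable_plus: "(+) z \<in> lebesgue \<rightarrow>\<^sub>M lebesgue"
    and lebesgue_distr_plus: "distr lebesgue lebesgue ((+) z) = lebesgue"
proof -
  \<comment> \<open>A translation is the affine map all of whose scaling factors are 1.\<close>
  have T: "(\<lambda>x. z + (\<Sum>j\<in>Basis. (1 * (x \<bullet> j)) *\<^sub>R j)) = (+) z"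
    by (simp add: euclidean_representation fun_eq_iff)
  show "(+) z \<in> lebesgue \<rightarrow>\<^sub>M lebesgue"
    using lebesgue_affine_measurable[of "\<lambda>_. 1" z] unfolding T by simp
  show "distr lebesgue lebesgue ((+) z) = lebesgue"
    using lebesgue_affine_euclidean[of "\<lambda>_. 1" z] unfolding T by (simp add: density_1)
qed

lemma nn_integral_lebesgue_plus:
  assumes "f \<in> borel_measurable lebesgue"
  shows "(\<integral>\<^sup>+x. f (z + x) \<partial>lebesgue) = (\<integral>\<^sup>+x. f x \<partial>lebesgue)"
proof -
  have "(\<integral>\<^sup>+x. f x \<partial>lebesgue) = (\<integral>\<^sup>+x. f x \<partial>distr lebesgue lebesgue ((+) z))"
    by (simp add: lebesgue_distr_plus)
  also have "\<dots> = (\<integral>\<^sup>+x. f (z + x) \<partial>lebesgue)"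
    using assms by (intro nn_integral_distr lebesgue_measurable_plus) auto
  finally show ?thesis by simp
qed

text \<open>Subtracting the integer parts is the only lattice shift that brings \<open>x\<close>
  into the cube; the half-open sides make the count exactly 1.\<close>

lemma unit_cell_lattice_partition:
  fixes x :: "real ^ 'd"
  shows "(\<integral>\<^sup>+z. indicator {y. \<forall>i. 0 \<le> y $ i \<and> y $ i < 1} (z + x) \<partial>count_space int_lattice) = (1::ennreal)"
proof -
  define Q where "Q = {y :: real ^ 'd. \<forall>i. 0 \<le> y $ i \<and> y $ i < 1}"
  define z0 where "z0 = ((\<chi> i. - of_int \<lfloor>x $ i\<rfloor>) :: real ^ 'd)"
  have z0: "z0 \<in> int_lattice" by (simp add: z0_def int_lattice_def)
  have in_Q: "z0 + x \<in> Q"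
  proof -
    have "0 \<le> x $ i - of_int \<lfloor>x $ i\<rfloor> \<and> x $ i - of_int \<lfloor>x $ i\<rfloor> < 1" for i
      by linarith
    then show ?thesis by (simp add: z0_def Q_def)
  qed
  have uniq: "z = z0" if "z \<in> int_lattice" "z + x \<in> Q" for z
  proof -
    have "z $ i = - of_int \<lfloor>x $ i\<rfloor>" for i
    proof -
      obtain k where k: "z $ i = of_int k"
        using \<open>z \<in> int_lattice\<close> by (auto simp: int_lattice_def elim: Ints_cases)
      have "0 \<le> of_int k + x $ i" "of_int k + x $ i < 1"
        using that(2) by (auto simp: Q_def simp flip: k)
      then have "\<lfloor>x $ i\<rfloor> = - k" by (intro floor_unique) auto
      then show ?thesis by (simp add: k)
    qed
    then show ?thesis by (simp add: z0_def vec_eq_iff)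
  qed
  have "(\<integral>\<^sup>+z. indicator Q (z + x) \<partial>count_space int_lattice) =
      (\<Sum>z\<in>{z0}. indicator Q (z + x) :: ennreal)"
    using z0 uniq by (intro nn_integral_count_space') (auto simp: indicator_def)
  then show ?thesis using in_Q by (simp flip: Q_def)
qed

text \<open>Jensen's inequality for the cell average, with extended values so that the right-hand
  side may be infinite.\<close>

lemma projection_L2_le:
  fixes u :: "real ^ 'd \<Rightarrow> real ^ 'd"
  assumes K: "K \<in> lmeasurable" and pos: "cell_measure K > 0"
  shows "ennreal (cell_measure K * (norm (projection u K))\<^sup>2) \<le>
    (\<integral>\<^sup>+x\<in>K. ennreal ((norm (u x))\<^sup>2) \<partial>lebesgue)"
proof (cases "set_integrable lebesgue K u")
  case True
  define f where "f x = indicator K x *\<^sub>R u x" for x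
  define c where "c = projection u K"
  have int: "integrable lebesgue f"
    using True by (simp add: set_integrable_def f_def [abs_def])
  have c: "integral\<^sup>L lebesgue f = cell_measure K *\<^sub>R c"
    using pos by (simp add: c_def projection_def set_lebesgue_integral_def f_def [abs_def])
  \<comment> \<open>\<open>h\<close> bounds \<open>|u|\<^sup>2\<close> from below because \<open>|u - c|\<^sup>2 \<ge> 0\<close>.\<close>
  define h where "h x = 2 * (c \<bullet> f x) - (norm c)\<^sup>2 * indicator K x" for x
  have intK: "integrable lebesgue (indicator K :: _ \<Rightarrow> real)"
    using K by (intro integrable_real_indicator) (auto simp: fmeasurable_def)
  have h: "integrable lebesgue h"
    unfolding h_def using int intK by (intro Bochner_Integration.integrable_diff integrable_mult_right
        integrable_inner_right) auto
  have "integral\<^sup>L lebesgue h = 2 * (c \<bullet> (cell_measure K *\<^sub>R c)) - (norm c)\<^sup>2 * cell_measure K"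
    unfolding h_def c[symmetric] using int intK
    by (subst Bochner_Integration.integral_diff) (auto simp: cell_measure_def)
  then have "cell_measure K * (norm c)\<^sup>2 = integral\<^sup>L lebesgue h"
    by (simp add: power2_norm_eq_inner)
  \<comment> \<open>Cutting off at 0 permits the passage to nonnegative integrals; the cut-off
    function still lies below the squared norm of \<open>u\<close> on \<open>K\<close>.\<close>
  also have "\<dots> \<le> integral\<^sup>L lebesgue (\<lambda>x. max 0 (h x))"
    using h by (intro integral_mono) auto
  finally have "ennreal (cell_measure K * (norm c)\<^sup>2) \<le> ennreal (integral\<^sup>L lebesgue (\<lambda>x. max 0 (h x)))"
    by (rule ennreal_leI)
  also have "\<dots> = (\<integral>\<^sup>+x. ennreal (max 0 (h x)) \<partial>lebesgue)"
    using h by (intro nn_integral_eq_integral[symmetric]) auto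
  also have "\<dots> \<le> (\<integral>\<^sup>+x\<in>K. ennreal ((norm (u x))\<^sup>2) \<partial>lebesgue)"
  proof (intro nn_integral_mono)
    fix x
    have "2 * (c \<bullet> u x) = (norm c)\<^sup>2 + (norm (u x))\<^sup>2 - (norm (c - u x))\<^sup>2"
      by (simp add: dot_norm_neg)
    then have "2 * (c \<bullet> u x) - (norm c)\<^sup>2 \<le> (norm (u x))\<^sup>2"
      using zero_le_power2[of "norm (c - u x)"] by linarith
    then show "ennreal (max 0 (h x)) \<le> ennreal ((norm (u x))\<^sup>2) * indicator K x"
      by (auto simp: h_def f_def indicator_def intro!: ennreal_leI)
  qed
  finally show ?thesis by (simp add: c_def)
next
  case False
  \<comment> \<open>The integral of a non-integrable function is 0 by convention, so
    \<open>projection u K\<close> vanishes here.\<close>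
  then have "(LINT x:K|lebesgue. u x) = 0"
    unfolding set_integrable_def set_lebesgue_integral_def by (rule not_integrable_integral_eq)
  then show ?thesis by (simp add: projection_def)
qed

section \<open>Summation over the cells of the torus\<close>

context mesh
begin

text \<open>Shifting by \<open>- y\<close> reduces the claim to the disjointness of the interiors of
  \<open>K\<close> and of the lift of \<open>L\<close> by \<open>z - y\<close>.\<close>

lemma lift_interior_unique:
  assumes "K \<in> \<T>" "L \<in> \<T>" "y \<in> int_lattice" "z \<in> int_lattice"
    and "x \<in> lift y (interior K)" "x \<in> lift z (interior L)"
  shows "L = K \<and> z = y"
proof (rule ccontr)
  assume "\<not> (L = K \<and> z = y)"
  then have "interior K \<inter> interior (lift (z - y) L) = {}"
    using assms by (intro interior_disjoint int_lattice_diff) auto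
  then have "lift y (interior K) \<inter> lift y (interior (lift (z - y) L)) = {}"
    by (metis lift_Int lift_def image_empty)
  then show False
    using assms by (auto simp: interior_lift lift_lift)
qed

text \<open>Lifted interiors are pairwise disjoint, so the total count at \<open>x\<close> is 0 or
  1.\<close>

lemma lifts_multiplicity_le_one:
  "(\<Sum>K\<in>\<T>. \<integral>\<^sup>+z. indicator (lift z (interior K)) x \<partial>count_space int_lattice) \<le> (1::ennreal)"
proof (cases "\<exists>K\<in>\<T>. \<exists>z\<in>int_lattice. x \<in> lift z (interior K)")
  case True
  then obtain K0 z0 where 0: "K0 \<in> \<T>" "z0 \<in> int_lattice" "x \<in> lift z0 (interior K0)"
    by blast
  have "(\<integral>\<^sup>+z. indicator (lift z (interior K)) x \<partial>count_space int_lattice) =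
      (if K = K0 then 1 else 0 :: ennreal)" if "K \<in> \<T>" for K
  proof -
    have "(\<integral>\<^sup>+z. indicator (lift z (interior K)) x \<partial>count_space int_lattice) =
        (\<Sum>z\<in>{z0}. indicator (lift z (interior K)) x :: ennreal)"
      using lift_interior_unique[OF 0(1) that 0(2)] 0
      by (intro nn_integral_count_space') (auto simp: indicator_def)
    then show ?thesis
      using lift_interior_unique[OF 0(1) that 0(2,2)] 0 by (auto simp: indicator_def)
  qed
  then show ?thesis using finite_mesh by simp
next
  case False
  then have "(\<integral>\<^sup>+z. indicator (lift z (interior K)) x \<partial>count_space int_lattice) = (0::ennreal)"
    if "K \<in> \<T>" for K
    using that by (intro nn_integral_count_space'[where A = "{}", simplified]) (auto simp: indicator_def)
  then show ?thesis by simp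
qed

text \<open>Lattice translates of the half-open cube cut each cell into pieces. Moving the pieces
  into \<open>Q\<close> preserves \<open>g\<close> by periodicity, and inside \<open>Q\<close> they
  do not overlap up to null sets.\<close>

lemma sum_nn_integral_cells_le:
  fixes g :: "real ^ 'd \<Rightarrow> ennreal"
  assumes g [measurable]: "g \<in> borel_measurable lebesgue" and per: "periodic g"
  shows "(\<Sum>K\<in>\<T>. \<integral>\<^sup>+x\<in>K. g x \<partial>lebesgue) \<le> (\<integral>\<^sup>+x\<in>cbox 0 1. g x \<partial>lebesgue)"
proof -
  define Q :: "(real ^ 'd) set" where "Q = {y. \<forall>i. 0 \<le> y $ i \<and> y $ i < 1}"
  have "Q = (\<Inter>i. {y. 0 \<le> y $ i} \<inter> {y. y $ i < 1})" by (auto simp: Q_def)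
  moreover have "\<dots> \<in> sets borel"
    by (intro sets.countable_INT'' sets.Int borel_closed borel_open closed_Collect_le
        open_Collect_less continuous_intros) auto
  ultimately have Q [measurable]: "Q \<in> sets lebesgue"
    by (auto intro: sets_completionI_sets)
  have Q_partition: "(\<integral>\<^sup>+z. indicator Q (z + x) \<partial>count_space int_lattice) = (1::ennreal)" for x
    unfolding Q_def by (rule unit_cell_lattice_partition)
  have lift_m [measurable]: "lift z (interior K) \<in> sets lebesgue" for z and K :: "'d cell"
    by (auto simp: interior_lift[symmetric])
  have cell: "(\<integral>\<^sup>+x\<in>K. g x \<partial>lebesgue) =
      (\<integral>\<^sup>+z. \<integral>\<^sup>+x. g x * indicator Q x * indicator (lift z (interior K)) x
        \<partial>lebesgue \<partial>count_space int_lattice)"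
    if KT: "K \<in> \<T>" for K
  proof -
    obtain a b where K: "K = cbox a b" using cellE[OF KT] by metis
    \<comment> \<open>Only interiors are known to be disjoint, so the null boundary of the box is
      discarded.\<close>
    have "AE x in lebesgue. x \<notin> cbox a b - box a b"
      by (intro AE_not_in AE_completion) (use null_sets_cbox_Diff_box in \<open>auto intro: null_sets_completionI\<close>)
    then have "(\<integral>\<^sup>+x\<in>K. g x \<partial>lebesgue) = (\<integral>\<^sup>+x. g x * indicator (interior K) x \<partial>lebesgue)"
      using box_subset_cbox[of a b] unfolding K interior_cbox
      by (intro nn_integral_cong_AE) (auto simp: indicator_def elim!: eventually_mono)
    \<comment> \<open>The factor 1 is written as the sum, over all lattice shifts, of the shifted
      indicators of \<open>Q\<close>.\<close>
    also have "\<dots> = (\<integral>\<^sup>+x. \<integral>\<^sup>+z. g x * indicator (interior K) x * indicator Q (z + x)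
        \<partial>count_space int_lattice \<partial>lebesgue)"
      by (simp add: nn_integral_cmult Q_partition)
    also have "\<dots> = (\<integral>\<^sup>+z. \<integral>\<^sup>+x. g x * indicator (interior K) x * indicator Q (z + x)
        \<partial>lebesgue \<partial>count_space int_lattice)"
    proof (intro nn_integral_count_space_nn_integral countable_int_lattice)
      fix z :: "real ^ 'd"
      have [measurable]: "(\<lambda>x. indicator Q (z + x) :: ennreal) \<in> borel_measurable lebesgue"
        by (rule measurable_compose[OF lebesgue_measurable_plus borel_measurable_indicator[OF Q]])
      have [measurable]: "interior K \<in> sets lebesgue" by simp
      show "(\<lambda>x. g x * indicator (interior K) x * indicator Q (z + x)) \<in> borel_measurable lebesgue"
        by measurable
    qed
    \<comment> \<open>Periodicity of \<open>g\<close> puts the whole integrand in terms of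
      \<open>z + x\<close>, ready for translation invariance.\<close>
    also have "\<dots> = (\<integral>\<^sup>+z. \<integral>\<^sup>+x. g (z + x) * indicator (lift z (interior K)) (z + x) * indicator Q (z + x)
        \<partial>lebesgue \<partial>count_space int_lattice)"
    proof (intro nn_integral_cong)
      fix z x :: "real ^ 'd" assume "z \<in> space (count_space int_lattice)"
      then have "g (z + x) = g x"
        using per unfolding periodic_def by (metis add.commute space_count_space)
      moreover have "z + x \<in> lift z (interior K) \<longleftrightarrow> x \<in> interior K"
        by (auto simp: lift_def)
      ultimately show "g x * indicator (interior K) x * indicator Q (z + x) =
          g (z + x) * indicator (lift z (interior K)) (z + x) * indicator Q (z + x)"
        by (simp only: indicator_def)
    qed
    also have "\<dots> = (\<integral>\<^sup>+z. \<integral>\<^sup>+x. g x * indicator (lift z (interior K)) x * indicator Q x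
        \<partial>lebesgue \<partial>count_space int_lattice)"
      by (intro nn_integral_cong nn_integral_lebesgue_plus) measurable
    finally show ?thesis by (simp add: mult_ac)
  qed
  have "(\<Sum>K\<in>\<T>. \<integral>\<^sup>+x\<in>K. g x \<partial>lebesgue) = (\<integral>\<^sup>+z. \<integral>\<^sup>+x.
      (\<Sum>K\<in>\<T>. g x * indicator Q x * indicator (lift z (interior K)) x) \<partial>lebesgue \<partial>count_space int_lattice)"
    by (simp add: cell nn_integral_sum)
  also have "\<dots> = (\<integral>\<^sup>+x. \<integral>\<^sup>+z.
      (\<Sum>K\<in>\<T>. g x * indicator Q x * indicator (lift z (interior K)) x) \<partial>count_space int_lattice \<partial>lebesgue)"
    by (intro nn_integral_count_space_nn_integral[symmetric] countable_int_lattice) measurable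
  also have "\<dots> = (\<integral>\<^sup>+x. g x * indicator Q x *
      (\<Sum>K\<in>\<T>. \<integral>\<^sup>+z. indicator (lift z (interior K)) x \<partial>count_space int_lattice) \<partial>lebesgue)"
    by (simp add: nn_integral_sum nn_integral_cmult sum_distrib_left)
  also have "\<dots> \<le> (\<integral>\<^sup>+x. g x * indicator Q x \<partial>lebesgue)"
  proof (intro nn_integral_mono)
    fix x
    show "g x * indicator Q x * (\<Sum>K\<in>\<T>. \<integral>\<^sup>+z. indicator (lift z (interior K)) x
        \<partial>count_space int_lattice) \<le> g x * indicator Q x"
      using mult_left_mono[OF lifts_multiplicity_le_one[of x], of "g x * indicator Q x"] by simp
  qed
  also have "\<dots> \<le> (\<integral>\<^sup>+x\<in>cbox 0 1. g x \<partial>lebesgue)"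
  proof (intro nn_integral_mono mult_left_mono)
    have "Q \<subseteq> cbox 0 1" by (auto simp: Q_def mem_box_cart less_imp_le)
    then show "indicator Q x \<le> (indicator (cbox 0 1) x :: ennreal)" for x
      by (auto simp: indicator_def)
  qed simp
  finally show ?thesis .
qed

text \<open>Jensen's inequality on every cell and periodicity give a bound free of the mesh; this
  allows the final constant to be fixed in advance.\<close>

lemma projection_energy_le:
  fixes u :: "real ^ 'd \<Rightarrow> real ^ 'd"
  assumes u: "u \<in> borel_measurable lebesgue" "periodic u"
    and L2: "set_integrable lebesgue (cbox 0 1) (\<lambda>x. (norm (u x))\<^sup>2)"
  shows "(\<Sum>K\<in>\<T>. cell_measure K * (norm (projection u K))\<^sup>2) \<le>
    (LINT x:cbox 0 1|lebesgue. (norm (u x))\<^sup>2)"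
proof -
  have lm: "K \<in> lmeasurable" if "K \<in> \<T>" for K
    using cellE[OF that] by (metis lmeasurable_cbox)
  have "ennreal (\<Sum>K\<in>\<T>. cell_measure K * (norm (projection u K))\<^sup>2) =
      (\<Sum>K\<in>\<T>. ennreal (cell_measure K * (norm (projection u K))\<^sup>2))"
    by (intro sum_ennreal[symmetric]) (simp add: cell_measure_pos less_imp_le)
  also have "\<dots> \<le> (\<Sum>K\<in>\<T>. \<integral>\<^sup>+x\<in>K. ennreal ((norm (u x))\<^sup>2) \<partial>lebesgue)"
    by (intro sum_mono projection_L2_le lm cell_measure_pos)
  also have "\<dots> \<le> (\<integral>\<^sup>+x\<in>cbox 0 1. ennreal ((norm (u x))\<^sup>2) \<partial>lebesgue)"
    using u by (intro sum_nn_integral_cells_le) (auto simp: periodic_def)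
  also have "\<dots> = (\<integral>\<^sup>+x. ennreal (indicator (cbox 0 1) x *\<^sub>R (norm (u x))\<^sup>2) \<partial>lebesgue)"
    by (intro nn_integral_cong) (auto simp: indicator_def)
  also have "\<dots> = ennreal (LINT x:cbox 0 1|lebesgue. (norm (u x))\<^sup>2)"
    using L2 unfolding set_integrable_def set_lebesgue_integral_def
    by (intro nn_integral_eq_integral) auto
  finally show ?thesis
    by (subst (asm) ennreal_le_iff) (auto simp: set_lebesgue_integral_def intro!: integral_nonneg_AE)
qed

end

section \<open>The discrete energy inequality\<close>

text \<open>Cauchy-Schwarz after splitting each weight as
  \<open>sqrt (c i) * sqrt (c i)\<close>.\<close>

lemma norm_weighted_sum_squared_le:
  fixes d :: "'i \<Rightarrow> 'a::real_normed_vector"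
  assumes c: "\<And>i. i \<in> I \<Longrightarrow> c i \<ge> 0"
  shows "(norm (\<Sum>i\<in>I. c i *\<^sub>R d i))\<^sup>2 \<le> (\<Sum>i\<in>I. c i) * (\<Sum>i\<in>I. c i * (norm (d i))\<^sup>2)"
proof -
  have "norm (\<Sum>i\<in>I. c i *\<^sub>R d i) \<le> (\<Sum>i\<in>I. sqrt (c i) * (sqrt (c i) * norm (d i)))"
  proof (rule sum_norm_le)
    fix i assume "i \<in> I"
    have eq: "sqrt (c i) * (sqrt (c i) * norm (d i)) = c i * norm (d i)"
      using c[OF \<open>i \<in> I\<close>] by (simp flip: mult.assoc)
    show "norm (c i *\<^sub>R d i) \<le> sqrt (c i) * (sqrt (c i) * norm (d i))"
      using c[OF \<open>i \<in> I\<close>] unfolding eq by simp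
  qed
  then have "(norm (\<Sum>i\<in>I. c i *\<^sub>R d i))\<^sup>2 \<le> (\<Sum>i\<in>I. sqrt (c i) * (sqrt (c i) * norm (d i)))\<^sup>2"
    by (intro power_mono) auto
  also have "\<dots> \<le> (\<Sum>i\<in>I. (sqrt (c i))\<^sup>2) * (\<Sum>i\<in>I. (sqrt (c i) * norm (d i))\<^sup>2)"
    by (rule Cauchy_Schwarz_ineq_sum)
  also have "\<dots> = (\<Sum>i\<in>I. c i) * (\<Sum>i\<in>I. c i * (norm (d i))\<^sup>2)"
    using c by (simp add: power_mult_distrib)
  finally show ?thesis .
qed

lemma normal_comp_diff: "normal_comp (\<lambda>K. u K - w K) K e = normal_comp u K e - normal_comp w K e"
  by (simp add: normal_comp_def inner_diff_left inner_add_left algebra_simps)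

text \<open>A number is the sum of its positive and negative parts, so the split fluxes recombine to
  the flux of \<open>v - d\<close>, although they need not be its own positive and negative
  parts.\<close>

lemma flux_plus_minus: "flux_plus v d K e + flux_minus v d K e = normal_comp (\<lambda>L. v L - d L) K e"
  by (simp add: flux_plus_def flux_minus_def normal_comp_diff pos_part_def neg_part_def field_simps)

lemma flux_minus_nonpos: "flux_minus v d K e \<le> 0"
  by (simp add: flux_minus_def pos_part_def neg_part_def)

context mesh
begin

text \<open>Since the normal component changes sign, what leaves \<open>K\<close> enters its
  neighbour.\<close>

lemma flux_minus_swap:
  assumes "K \<in> \<T>" "e \<in> edges \<T> K"
  shows "flux_minus v d (fst e) (K, - snd e) = - flux_plus v d K e"
  using assms by (simp add: flux_minus_def flux_plus_def normal_comp_swap pos_part_def neg_part_def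
      field_simps)

lemma disc_div_eq:
  assumes "K \<in> \<T>"
  shows "cell_measure K * disc_div \<T> w K =
    (\<Sum>e\<in>edges \<T> K. edge_measure (edge_set K e) * normal_comp w K e)"
  using cell_measure_pos[OF assms] by (simp add: disc_div_def)

text \<open>Discrete integration by parts: the gradient and divergence terms combine, edge by edge,
  to a quantity antisymmetric under exchange of sides, whose total is zero.\<close>

lemma disc_grad_div_duality:
  "(\<Sum>K\<in>\<T>. cell_measure K * (disc_grad \<T> q K \<bullet> w K)) =
    - (\<Sum>K\<in>\<T>. cell_measure K * (q K * disc_div \<T> w K))"
proof -
  define A where "A K e = edge_measure (edge_set K e)" for K :: "'d cell" and e :: "'d edge"
  define \<nu> where "\<nu> K e = outer_normal (edge_set K e) K" for K :: "'d cell" and e :: "'d edge"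
  \<comment> \<open>The products of \<open>q K\<close> with \<open>w K\<close> cancel between
    gradient and divergence; what remains is symmetric in the two cells except for the
    normal.\<close>
  define f where "f K e = A K e * (\<nu> K e \<bullet> (q (fst e) *\<^sub>R w K + q K *\<^sub>R w (fst e)) / 2)" for K e
  have swap: "f (fst e) (K, - snd e) = - f K e" if "K \<in> \<T>" "e \<in> edges \<T> K" for K e
    using outer_normal_swap[of K "fst e" "snd e"] edge_measure_swap[of K "fst e" "snd e"] that
    by (simp add: f_def A_def \<nu>_def add.commute)
  have "(\<Sum>K\<in>\<T>. \<Sum>e\<in>edges \<T> K. f K e) = (\<Sum>K\<in>\<T>. \<Sum>e\<in>edges \<T> K. f (fst e) (K, - snd e))"
    by (rule edge_sum_swap)
  also have "\<dots> = - (\<Sum>K\<in>\<T>. \<Sum>e\<in>edges \<T> K. f K e)"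
    by (simp add: swap sum_negf)
  finally have zero: "(\<Sum>K\<in>\<T>. \<Sum>e\<in>edges \<T> K. f K e) = 0" by simp
  have "cell_measure K * (disc_grad \<T> q K \<bullet> w K) + cell_measure K * (q K * disc_div \<T> w K) =
      (\<Sum>e\<in>edges \<T> K. f K e)" if K: "K \<in> \<T>" for K
  proof -
    have "cell_measure K * (disc_grad \<T> q K \<bullet> w K) =
        (\<Sum>e\<in>edges \<T> K. A K e * ((q (fst e) - q K) / 2) * (\<nu> K e \<bullet> w K))"
      using cell_measure_pos[OF K] by (simp add: disc_grad_def inner_sum_left A_def \<nu>_def)
    moreover have "cell_measure K * (q K * disc_div \<T> w K) =
        (\<Sum>e\<in>edges \<T> K. q K * (A K e * normal_comp w K e))"
      using disc_div_eq[OF K, of w] by (simp add: A_def mult.left_commute flip: sum_distrib_left)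
    moreover have "A K e * ((q (fst e) - q K) / 2) * (\<nu> K e \<bullet> w K) +
        q K * (A K e * normal_comp w K e) = f K e" for e
    proof -
      have "normal_comp w K e = (\<nu> K e \<bullet> w K + \<nu> K e \<bullet> w (fst e)) / 2"
        by (simp add: normal_comp_def \<nu>_def inner_add_left inner_commute[of "outer_normal _ _"])
      then show ?thesis by (simp add: f_def inner_add_right field_simps)
    qed
    ultimately show ?thesis by (simp add: sum.distrib[symmetric])
  qed
  then have "(\<Sum>K\<in>\<T>. cell_measure K * (disc_grad \<T> q K \<bullet> w K)) +
      (\<Sum>K\<in>\<T>. cell_measure K * (q K * disc_div \<T> w K)) = 0"
    using zero by (simp add: sum.distrib[symmetric])
  then show ?thesis by simp
qed

text \<open>Summed over all cells, each edge enters from both sides, in total with weight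
  \<open>flux_plus - flux_minus\<close> times its measure, because inflow on one side is outflow on
  the other.\<close>

definition upwind_dissipation ::
    "('d cell \<Rightarrow> real ^ 'd) \<Rightarrow> ('d cell \<Rightarrow> real ^ 'd) \<Rightarrow> 'd cell \<Rightarrow> real" where
  "upwind_dissipation v d K = (\<Sum>e\<in>edges \<T> K.
     edge_measure (edge_set K e) * (- flux_minus v d K e) * (norm (v (fst e) - v K))\<^sup>2)"

section \<open>Convection by a divergence-free flux\<close>

context
  fixes v d :: "'d cell \<Rightarrow> real ^ 'd"
  assumes div_free: "\<And>K. K \<in> \<T> \<Longrightarrow> disc_div \<T> (\<lambda>L. v L - d L) K = 0"
begin

lemma net_flux_zero:
  assumes "K \<in> \<T>"
  shows "(\<Sum>e\<in>edges \<T> K. edge_measure (edge_set K e) * (flux_plus v d K e + flux_minus v d K e)) = 0"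
  using disc_div_eq[OF assms, of "\<lambda>L. v L - d L"] div_free[OF assms]
  by (simp add: flux_plus_minus)

text \<open>The net flux out of \<open>K\<close> vanishes, so a multiple of \<open>v K\<close> can
  be removed; only inflow differences remain, the non-conservative form of upwinding.\<close>

lemma disc_div_up_eq:
  assumes K: "K \<in> \<T>"
  shows "cell_measure K *\<^sub>R disc_div_up \<T> v (flux_plus v d) (flux_minus v d) K =
    (\<Sum>e\<in>edges \<T> K. (edge_measure (edge_set K e) * flux_minus v d K e) *\<^sub>R (v (fst e) - v K))"
proof -
  define A where "A e = edge_measure (edge_set K e)" for e :: "'d edge"
  have "cell_measure K *\<^sub>R disc_div_up \<T> v (flux_plus v d) (flux_minus v d) K =
      (\<Sum>e\<in>edges \<T> K. A e *\<^sub>R (flux_plus v d K e *\<^sub>R v K + flux_minus v d K e *\<^sub>R v (fst e)))"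
    using cell_measure_pos[OF K] by (simp add: disc_div_up_def A_def)
  also have "\<dots> = (\<Sum>e\<in>edges \<T> K. (A e * (flux_plus v d K e + flux_minus v d K e)) *\<^sub>R v K +
      (A e * flux_minus v d K e) *\<^sub>R (v (fst e) - v K))"
    by (intro sum.cong refl) (simp add: algebra_simps)
  also have "\<dots> = (\<Sum>e\<in>edges \<T> K. A e * (flux_plus v d K e + flux_minus v d K e)) *\<^sub>R v K +
      (\<Sum>e\<in>edges \<T> K. (A e * flux_minus v d K e) *\<^sub>R (v (fst e) - v K))"
    by (simp add: sum.distrib scaleR_sum_left)
  finally show ?thesis using net_flux_zero[OF K] by (simp add: A_def)
qed

text \<open>Polarisation splits the product with \<open>v K\<close> into a difference of energies
  and a squared jump. The former sums to zero for a divergence-free flux; the latter is the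
  dissipation.\<close>

lemma convection_energy:
  "(\<Sum>K\<in>\<T>. cell_measure K * (disc_div_up \<T> v (flux_plus v d) (flux_minus v d) K \<bullet> v K)) =
    (\<Sum>K\<in>\<T>. upwind_dissipation v d K) / 2"
proof -
  define A where "A K e = edge_measure (edge_set K e)" for K :: "'d cell" and e :: "'d edge"
  let ?wp = "flux_plus v d" and ?wm = "flux_minus v d"
  have A_swap: "A (fst e) (K, - snd e) = A K e" if "K \<in> \<T>" "e \<in> edges \<T> K" for K e
    using edge_measure_swap[of K "fst e" "snd e"] that by (simp add: A_def)
  \<comment> \<open>Seen from the other side, inflow of the neighbour's energy is outflow of the
    cell's own energy; joined with the inflow term, it produces the net flux.\<close>
  have "(\<Sum>K\<in>\<T>. \<Sum>e\<in>edges \<T> K. A K e * ?wm K e * (norm (v (fst e)))\<^sup>2) =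
      (\<Sum>K\<in>\<T>. \<Sum>e\<in>edges \<T> K. - (A K e * ?wp K e * (norm (v K))\<^sup>2))"
    by (subst edge_sum_swap) (simp add: A_swap flux_minus_swap)
  then have "(\<Sum>K\<in>\<T>. \<Sum>e\<in>edges \<T> K. A K e * ?wm K e * ((norm (v (fst e)))\<^sup>2 - (norm (v K))\<^sup>2)) =
      (\<Sum>K\<in>\<T>. \<Sum>e\<in>edges \<T> K. - (A K e * ?wp K e * (norm (v K))\<^sup>2)) -
      (\<Sum>K\<in>\<T>. \<Sum>e\<in>edges \<T> K. A K e * ?wm K e * (norm (v K))\<^sup>2)"
    by (simp add: right_diff_distrib sum_subtractf)
  also have "\<dots> = - (\<Sum>K\<in>\<T>. (norm (v K))\<^sup>2 * (\<Sum>e\<in>edges \<T> K. A K e * (?wp K e + ?wm K e)))"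
    unfolding sum_negf[symmetric] sum_subtractf[symmetric] sum_distrib_left
    by (intro sum.cong refl) (simp add: algebra_simps)
  also have "\<dots> = 0"
    using net_flux_zero by (simp add: A_def)
  finally have zero: "(\<Sum>K\<in>\<T>. \<Sum>e\<in>edges \<T> K.
      A K e * ?wm K e * ((norm (v (fst e)))\<^sup>2 - (norm (v K))\<^sup>2)) = 0" .
  have "cell_measure K * (disc_div_up \<T> v ?wp ?wm K \<bullet> v K) =
      (\<Sum>e\<in>edges \<T> K. A K e * ?wm K e * ((norm (v (fst e)))\<^sup>2 - (norm (v K))\<^sup>2)) / 2 +
      upwind_dissipation v d K / 2" if K: "K \<in> \<T>" for K
  proof -
    have "cell_measure K * (disc_div_up \<T> v ?wp ?wm K \<bullet> v K) =
        (cell_measure K *\<^sub>R disc_div_up \<T> v ?wp ?wm K) \<bullet> v K" by simp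
    also have "\<dots> = (\<Sum>e\<in>edges \<T> K. A K e * ?wm K e * ((v (fst e) - v K) \<bullet> v K))"
      unfolding disc_div_up_eq[OF K] by (simp add: inner_sum_left A_def)
    also have "\<dots> = (\<Sum>e\<in>edges \<T> K. A K e * ?wm K e * ((norm (v (fst e)))\<^sup>2 - (norm (v K))\<^sup>2) / 2 +
        A K e * (- ?wm K e) * (norm (v (fst e) - v K))\<^sup>2 / 2)"
    proof (intro sum.cong refl)
      fix e :: "'d edge"
      have eq: "(v (fst e) - v K) \<bullet> v K =
          ((norm (v (fst e)))\<^sup>2 - (norm (v K))\<^sup>2 - (norm (v (fst e) - v K))\<^sup>2) / 2"
        by (simp add: power2_norm_eq_inner inner_diff_left inner_diff_right inner_commute)
      show "A K e * ?wm K e * ((v (fst e) - v K) \<bullet> v K) =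
          A K e * ?wm K e * ((norm (v (fst e)))\<^sup>2 - (norm (v K))\<^sup>2) / 2 +
          A K e * (- ?wm K e) * (norm (v (fst e) - v K))\<^sup>2 / 2"
        unfolding eq by (simp add: field_simps)
    qed
    finally show ?thesis
      by (simp only: upwind_dissipation_def A_def sum.distrib sum_divide_distrib)
  qed
  then show ?thesis
    using zero by (simp add: sum.distrib flip: sum_divide_distrib)
qed

text \<open>The weighted Cauchy-Schwarz inequality gives \<open>m^2 |U|^2 \<le> S D\<close>, and the
  time step condition gives \<open>\<delta>t S \<le> m / 2\<close>.\<close>

lemma upwind_norm_le:
  assumes K: "K \<in> \<T>" and dt: "\<delta>t > 0"
    and CFL: "(\<Sum>e\<in>edges \<T> K. edge_measure (edge_set K e) * (- flux_minus v d K e)) = S"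
      "S \<noteq> 0 \<longrightarrow> \<delta>t \<le> cell_measure K / (2 * S)"
  shows "\<delta>t * (cell_measure K * (norm (disc_div_up \<T> v (flux_plus v d) (flux_minus v d) K))\<^sup>2)
    \<le> upwind_dissipation v d K / 2"
proof -
  let ?U = "disc_div_up \<T> v (flux_plus v d) (flux_minus v d) K"
  define m where "m = cell_measure K"
  define D where "D = upwind_dissipation v d K"
  have m: "m > 0" using cell_measure_pos[OF K] by (simp add: m_def)
  define c where "c e = edge_measure (edge_set K e) * (- flux_minus v d K e)" for e
  have c: "c e \<ge> 0" for e
    unfolding c_def by (intro mult_nonneg_nonneg edge_measure_nonneg) (simp add: flux_minus_nonpos)
  have S: "sum c (edges \<T> K) = S" using CFL(1) by (simp add: c_def)
  have D: "D = (\<Sum>e\<in>edges \<T> K. c e * (norm (v (fst e) - v K))\<^sup>2)"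
    by (simp add: D_def upwind_dissipation_def c_def)
  have "S \<ge> 0" "D \<ge> 0" using c by (auto simp: D simp flip: S intro!: sum_nonneg)
  \<comment> \<open>For \<open>S = 0\<close> the time step condition is void, but the bound is then
    immediate from \<open>m > 0\<close>.\<close>
  have "\<delta>t * S \<le> m / 2"
  proof (cases "S = 0")
    case False
    then show ?thesis
      using CFL(2) \<open>S \<ge> 0\<close> by (simp add: m_def field_simps)
  qed (use m in simp)
  have "m *\<^sub>R ?U = - (\<Sum>e\<in>edges \<T> K. c e *\<^sub>R (v (fst e) - v K))"
    unfolding m_def disc_div_up_eq[OF K] by (simp add: c_def sum_negf)
  then have "(norm (m *\<^sub>R ?U))\<^sup>2 \<le> S * D"
    using norm_weighted_sum_squared_le[of "edges \<T> K" c "\<lambda>e. v (fst e) - v K"] c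
    by (simp add: S D)
  then have "\<delta>t * (m * (m * (norm ?U)\<^sup>2)) \<le> \<delta>t * (S * D)"
    using dt by (simp add: power_mult_distrib power2_eq_square mult_ac)
  also have "\<dots> \<le> m * (D / 2)"
    using mult_right_mono[OF \<open>\<delta>t * S \<le> m / 2\<close> \<open>D \<ge> 0\<close>] by (simp add: mult_ac)
  finally have "m * (\<delta>t * (m * (norm ?U)\<^sup>2)) \<le> m * (D / 2)"
    by (simp add: mult.left_commute)
  then show ?thesis
    using m by (simp add: m_def D_def)
qed

end

section \<open>Energy balance of one time step\<close>

lemma energy_step:
  fixes v v' :: "'d cell \<Rightarrow> real ^ 'd" and p :: "'d cell \<Rightarrow> real"
  assumes dt: "\<delta>t > 0"
    and d: "d = velocity_shift \<T> \<eta> \<delta>t p"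
    and div_free: "\<And>K. K \<in> \<T> \<Longrightarrow> disc_div \<T> (\<lambda>L. v L - d L) K = 0"
    and momentum: "\<And>K. K \<in> \<T> \<Longrightarrow> (1 / \<delta>t) *\<^sub>R (v' K - v K)
      + disc_div_up \<T> v (flux_plus v d) (flux_minus v d) K + disc_grad \<T> p K = 0"
    and CFL: "\<And>K S. K \<in> \<T> \<Longrightarrow>
      S = (\<Sum>e\<in>edges \<T> K. edge_measure (edge_set K e) * (- flux_minus v d K e)) \<Longrightarrow>
      S \<noteq> 0 \<Longrightarrow> \<delta>t \<le> cell_measure K / (2 * S)"
  shows "(\<Sum>K\<in>\<T>. cell_measure K * ((1 / 2) * (norm (v' K))\<^sup>2))
      + (\<eta> - 1) * (\<delta>t\<^sup>2 * (\<Sum>K\<in>\<T>. cell_measure K * (norm (disc_grad \<T> p K))\<^sup>2))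
    \<le> (\<Sum>K\<in>\<T>. cell_measure K * ((1 / 2) * (norm (v K))\<^sup>2))"
proof -
  define U where "U = disc_div_up \<T> v (flux_plus v d) (flux_minus v d)"
  define G where "G = disc_grad \<T> p"
  define D where "D = upwind_dissipation v d"
  define m where "m = (cell_measure :: 'd cell \<Rightarrow> real)"
  define P where "P = (\<Sum>K\<in>\<T>. m K * (norm (G K))\<^sup>2)"
  have pressure: "(\<Sum>K\<in>\<T>. m K * (G K \<bullet> v K)) = \<eta> * \<delta>t * P"
  proof -
    \<comment> \<open>The field \<open>v - d\<close> is discretely divergence free, so by duality
      the pressure gradient does no work on it, and \<open>v\<close> may be replaced by
      \<open>d\<close>.\<close>
    have "(\<Sum>K\<in>\<T>. m K * (G K \<bullet> (v K - d K))) = 0"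
      unfolding m_def G_def
      using disc_grad_div_duality[of p "\<lambda>K. v K - d K"] div_free by simp
    then have "(\<Sum>K\<in>\<T>. m K * (G K \<bullet> v K)) = (\<Sum>K\<in>\<T>. m K * (G K \<bullet> d K))"
      by (simp add: inner_diff_right right_diff_distrib sum_subtractf)
    also have "\<dots> = \<eta> * \<delta>t * P"
      unfolding P_def sum_distrib_left
      by (intro sum.cong refl) (simp add: d velocity_shift_def G_def power2_norm_eq_inner)
    finally show ?thesis .
  qed
  have convection: "(\<Sum>K\<in>\<T>. m K * (U K \<bullet> v K)) = (\<Sum>K\<in>\<T>. D K) / 2"
    unfolding m_def U_def D_def using div_free by (rule convection_energy)
  have "m K * ((1 / 2) * (norm (v' K))\<^sup>2) \<le> m K * ((1 / 2) * (norm (v K))\<^sup>2)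
      - \<delta>t * (m K * (U K \<bullet> v K)) - \<delta>t * (m K * (G K \<bullet> v K))
      + \<delta>t * (D K / 2) + \<delta>t\<^sup>2 * (m K * (norm (G K))\<^sup>2)" if K: "K \<in> \<T>" for K
  proof -
    have "\<delta>t *\<^sub>R ((1 / \<delta>t) *\<^sub>R (v' K - v K) + U K + G K) = 0"
      using momentum[OF K] by (simp add: U_def G_def)
    then have "v' K = v K - \<delta>t *\<^sub>R (U K + G K)"
      using dt by (simp add: algebra_simps)
    then have v': "(norm (v' K))\<^sup>2 = (norm (v K))\<^sup>2 - 2 * \<delta>t * (U K \<bullet> v K + G K \<bullet> v K)
        + \<delta>t\<^sup>2 * (norm (U K + G K))\<^sup>2"
      by (simp only: power2_norm_eq_inner)
         (simp add: algebra_simps inner_diff_left inner_add_left inner_add_right inner_diff_right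
          power2_eq_square inner_commute)
    \<comment> \<open>Parallelogram law. The factor 2 cancels the one half of the kinetic energy, so
      the upwind part matches the bound given by the time step condition.\<close>
    have "(norm (U K + G K))\<^sup>2 + (norm (U K - G K))\<^sup>2 = 2 * (norm (U K))\<^sup>2 + 2 * (norm (G K))\<^sup>2"
      by (simp only: power2_norm_eq_inner)
         (simp add: inner_diff_left inner_add_left inner_add_right inner_diff_right)
    then have "(norm (U K + G K))\<^sup>2 \<le> 2 * (norm (U K))\<^sup>2 + 2 * (norm (G K))\<^sup>2"
      using zero_le_power2[of "norm (U K - G K)"] by linarith
    then have "m K * \<delta>t\<^sup>2 * (norm (U K + G K))\<^sup>2 \<le> m K * \<delta>t\<^sup>2 * (2 * (norm (U K))\<^sup>2 + 2 * (norm (G K))\<^sup>2)"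
      using cell_measure_pos[OF K] by (intro mult_left_mono) (auto simp: m_def)
    moreover have "\<delta>t * (\<delta>t * (m K * (norm (U K))\<^sup>2)) \<le> \<delta>t * (D K / 2)"
      unfolding m_def U_def D_def
      using dt div_free K CFL[OF K refl] by (intro mult_left_mono upwind_norm_le) auto
    ultimately show ?thesis
      unfolding v' by (simp add: algebra_simps power2_eq_square)
  qed
  then have "(\<Sum>K\<in>\<T>. m K * ((1 / 2) * (norm (v' K))\<^sup>2)) \<le> (\<Sum>K\<in>\<T>. m K * ((1 / 2) * (norm (v K))\<^sup>2)
      - \<delta>t * (m K * (U K \<bullet> v K)) - \<delta>t * (m K * (G K \<bullet> v K))
      + \<delta>t * (D K / 2) + \<delta>t\<^sup>2 * (m K * (norm (G K))\<^sup>2))"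
    by (rule sum_mono)
  also have "\<dots> = (\<Sum>K\<in>\<T>. m K * ((1 / 2) * (norm (v K))\<^sup>2))
      - \<delta>t * (\<Sum>K\<in>\<T>. m K * (U K \<bullet> v K)) - \<delta>t * (\<Sum>K\<in>\<T>. m K * (G K \<bullet> v K))
      + \<delta>t * ((\<Sum>K\<in>\<T>. D K) / 2) + \<delta>t\<^sup>2 * P"
    by (simp only: sum.distrib sum_subtractf sum_distrib_left[symmetric] sum_divide_distrib[symmetric] P_def)
  \<comment> \<open>The bound on the upwind gain cancels the convective dissipation exactly; to the
    coefficient of \<open>\<delta>t^2 P\<close> the pressure work contributes
    \<open>- \<eta>\<close> and the explicit error 1.\<close>
  also have "\<dots> = (\<Sum>K\<in>\<T>. m K * ((1 / 2) * (norm (v K))\<^sup>2)) - (\<eta> - 1) * (\<delta>t\<^sup>2 * P)"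
    unfolding convection pressure by (simp add: algebra_simps power2_eq_square)
  finally show ?thesis
    by (simp add: P_def G_def m_def)
qed

end

theorem theorem6p12:
  fixes v\<^sub>0 :: "real ^ 'd \<Rightarrow> real ^ 'd" and s :: real
  assumes "CARD('d) \<in> {2, 3}"
    and "s > real CARD('d) / 2 + 1"
    and "v\<^sub>0 \<in> sobolev_torus s"
    and "divergence_free v\<^sub>0"
  shows "\<exists>C>0. \<forall>(\<T> :: 'd cell set) (\<eta> :: real) (\<delta>t :: real) (T :: real) (N :: nat)
           (v :: nat \<Rightarrow> 'd cell \<Rightarrow> real ^ 'd) (p :: nat \<Rightarrow> 'd cell \<Rightarrow> real).
      periodic_mesh \<T> \<and> T > 0 \<and> \<delta>t > 0 \<and> real N * \<delta>t = T \<and> \<eta> > 1 \<and>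
      limit_scheme \<T> v\<^sub>0 \<eta> \<delta>t N v p \<and>
      time_step_condition \<T> \<eta> \<delta>t N v p \<longrightarrow>
      (\<forall>n\<in>{1..N - 1}.
        (\<Sum>K\<in>\<T>. cell_measure K * ((1 / 2) * (norm (v n K))\<^sup>2))
        + (\<eta> - 1) * (\<Sum>r=0..n - 1. \<delta>t\<^sup>2 *
            (\<Sum>K\<in>\<T>. cell_measure K * (norm (disc_grad \<T> (p (r + 1)) K))\<^sup>2)) \<le> C)"
proof -
  define M where "M = (LINT x:cbox 0 1|lebesgue. (norm (v\<^sub>0 x))\<^sup>2)"
  have M: "M \<ge> 0"
    unfolding M_def set_lebesgue_integral_def by (intro integral_nonneg_AE) auto
  have v0: "v\<^sub>0 \<in> borel_measurable lebesgue" "periodic v\<^sub>0"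
      "set_integrable lebesgue (cbox 0 1) (\<lambda>x. (norm (v\<^sub>0 x))\<^sup>2)"
    using assms(3) by (auto simp: sobolev_torus_def)
  show ?thesis
  \<comment> \<open>\<open>M / 2\<close> bounds the initial energy on every mesh; 1 is added because
    the constant must be positive even if \<open>v\<^sub>0\<close> vanishes almost
    everywhere.\<close>
  proof (intro exI[of _ "M / 2 + 1"] conjI allI impI ballI)
    show "M / 2 + 1 > 0" using M by simp
    fix \<T> :: "'d cell set" and \<eta> \<delta>t T :: real and N :: nat
      and v :: "nat \<Rightarrow> 'd cell \<Rightarrow> real ^ 'd" and p :: "nat \<Rightarrow> 'd cell \<Rightarrow> real" and n :: nat
    assume hyp: "periodic_mesh \<T> \<and> T > 0 \<and> \<delta>t > 0 \<and> real N * \<delta>t = T \<and> \<eta> > 1 \<and>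
      limit_scheme \<T> v\<^sub>0 \<eta> \<delta>t N v p \<and> time_step_condition \<T> \<eta> \<delta>t N v p"
      and n: "n \<in> {1..N - 1}"
    interpret mesh \<T> using hyp by unfold_locales blast
    define E where "E k = (\<Sum>K\<in>\<T>. cell_measure K * ((1 / 2) * (norm (v k K))\<^sup>2))" for k
    define P where "P r = \<delta>t\<^sup>2 * (\<Sum>K\<in>\<T>. cell_measure K * (norm (disc_grad \<T> (p (Suc r)) K))\<^sup>2)" for r
    have scheme: "limit_scheme \<T> v\<^sub>0 \<eta> \<delta>t N v p" and cfl: "time_step_condition \<T> \<eta> \<delta>t N v p"
      and dt: "\<delta>t > 0"
      using hyp by auto
    have step: "E (Suc k) + (\<eta> - 1) * P k \<le> E k" if "k < N" for k
      unfolding E_def P_def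
    proof (rule energy_step[OF dt refl])
      fix K assume K: "K \<in> \<T>"
      show "disc_div \<T> (\<lambda>L. v k L - velocity_shift \<T> \<eta> \<delta>t (p (Suc k)) L) K = 0"
        "(1 / \<delta>t) *\<^sub>R (v (Suc k) K - v k K)
          + disc_div_up \<T> (v k) (flux_plus (v k) (velocity_shift \<T> \<eta> \<delta>t (p (Suc k))))
              (flux_minus (v k) (velocity_shift \<T> \<eta> \<delta>t (p (Suc k)))) K
          + disc_grad \<T> (p (Suc k)) K = 0"
        using scheme that K by (simp_all add: limit_scheme_def Let_def)
    next
      fix K S
      assume "K \<in> \<T>" "S \<noteq> 0" and S: "S = (\<Sum>e\<in>edges \<T> K. edge_measure (edge_set K e) *
        (- flux_minus (v k) (velocity_shift \<T> \<eta> \<delta>t (p (Suc k))) K e))"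
      have "\<forall>n<N. \<forall>K\<in>\<T>. (\<Sum>e\<in>edges \<T> K. edge_measure (edge_set K e) *
          (- flux_minus (v n) (velocity_shift \<T> \<eta> \<delta>t (p (Suc n))) K e)) \<noteq> 0 \<longrightarrow>
        \<delta>t \<le> cell_measure K / (2 * (\<Sum>e\<in>edges \<T> K. edge_measure (edge_set K e) *
          (- flux_minus (v n) (velocity_shift \<T> \<eta> \<delta>t (p (Suc n))) K e)))"
        using cfl unfolding time_step_condition_def Let_def .
      then show "\<delta>t \<le> cell_measure K / (2 * S)"
        using that \<open>K \<in> \<T>\<close> \<open>S \<noteq> 0\<close> unfolding S by blast
    qed
    \<comment> \<open>The one-step inequalities telescope; step \<open>r\<close> uses the pressure
      \<open>p (Suc r)\<close>, so \<open>k\<close> steps involve the indices below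
      \<open>k\<close>.\<close>
    have "E k + (\<eta> - 1) * (\<Sum>r<k. P r) \<le> E 0" if "k \<le> N" for k
      using that
    proof (induction k)
      case (Suc k)
      then show ?case using step[of k] by (simp add: algebra_simps)
    qed simp
    moreover have "n \<le> N" using n by auto
    ultimately have "E n + (\<eta> - 1) * (\<Sum>r<n. P r) \<le> E 0" by blast
    moreover have "E 0 \<le> M / 2"
    proof -
      have "E 0 = (\<Sum>K\<in>\<T>. cell_measure K * (norm (projection v\<^sub>0 K))\<^sup>2) / 2"
        using scheme by (simp add: E_def limit_scheme_def sum_divide_distrib)
      then show ?thesis
        using projection_energy_le[OF v0] by (simp add: M_def)
    qed
    \<comment> \<open>This uses \<open>n \<ge> 1\<close>: with truncated subtraction, the left side
      would be \<open>{0}\<close> for \<open>n = 0\<close>.\<close>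
    moreover have "{0..n - 1} = {..<n}" using n by auto
    ultimately show "(\<Sum>K\<in>\<T>. cell_measure K * ((1 / 2) * (norm (v n K))\<^sup>2))
        + (\<eta> - 1) * (\<Sum>r=0..n - 1. \<delta>t\<^sup>2 *
            (\<Sum>K\<in>\<T>. cell_measure K * (norm (disc_grad \<T> (p (r + 1)) K))\<^sup>2)) \<le> M / 2 + 1"
      by (simp add: E_def P_def)
  qed
qed

end
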